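(* A set $S \subseteq 2^{\mathbb{N}}$ is Borel if and only if the infinite Karchmer--Wigderson game $\mathrm{KW}_{S,S^c}$ has a communication protocol, where $S^c = 2^{\mathbb{N}} \setminus S$.
   Context: $2^{\mathbb{N}}$ is the Cantor space of infinite binary strings $x = x_0x_1x_2\cdots$ with its usual product topology. Infinite communication protocols. Let $X = Y = 2^{\mathbb{N}}$ and let $Z$ be a countable set. A protocol $P$ is a countable, well-founded (no infinite branch) rooted tree in which each internal node $v$ is labeled either by a function $a_v \colon X \to \mathbb{N}$ (Alice's node) or by a function $b_v \colon Y \to \mathbb{N}$ (Bob's node), these functions being arbitrary, and each leaf is labeled by an element of $Z$. Every edge is labeled with some natural number, and for each internal node $v$ and each $n$ in the range of $a_v$ (resp. $b_v$), exactly one edge from $v$ to one of its children is labeled $n$. The protocol computes a function $P \colon X \times Y \to Z$: on input $(x,y)$ start at the root; at an internal node $v$ follow the edge labeled $a_v(x)$ (if $v$ is Alice's) or $b_v(y)$ (if $v$ is Bob's); output the label of the leaf eventually reached. KW games. For $A,B \subseteq 2^{\mathbb{N}}$, in the game $\mathrm{KW}_{A,B}$ Alice gets $x \in A$, Bob gets $y \in B$, and they must output some $i \in \mathbb{N}$ with $x_i \neq y_i$. A protocol $P$ with $Z = \mathbb{N}$ is a communication protocol for $\mathrm{KW}_{A,B}$ if for all $(x,y) \in A \times B$ the strings $x$ and $y$ differ at index $P(x,y)$. *)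

theory Defs
  imports "HOL-Analysis.Analysis"
begin

type_synonym cantor = "nat \<Rightarrow> bool"

datatype 'z node_label =
    Alice "cantor \<Rightarrow> nat"
  | Bob "cantor \<Rightarrow> nat"
  | Leaf 'z

text \<open>
  An edge \<open>(v, w)\<close> leads from the node \<open>v\<close> to its child \<open>w\<close>. The two labelling functions
  only matter on \<open>edges\<close> and on \<open>nodes\<close>, respectively.
\<close>

record ('v, 'z) protocol =
  nodes :: "'v set"
  root_node :: 'v
  edges :: "('v \<times> 'v) set"
  edge_label :: "'v \<times> 'v \<Rightarrow> nat"
  node_label :: "'v \<Rightarrow> 'z node_label"

definition rooted_tree :: "'v set \<Rightarrow> 'v \<Rightarrow> ('v \<times> 'v) set \<Rightarrow> bool" where
  "rooted_tree V r E \<longleftrightarrow>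
     r \<in> V \<and> E \<subseteq> V \<times> V \<and>
     (\<forall>v. (v, r) \<notin> E) \<and>
     (\<forall>w\<in>V - {r}. \<exists>!v. (v, w) \<in> E) \<and>
     (\<forall>v\<in>V. (r, v) \<in> E\<^sup>*)"

definition infinite_branch :: "'v \<Rightarrow> ('v \<times> 'v) set \<Rightarrow> (nat \<Rightarrow> 'v) \<Rightarrow> bool" where
  "infinite_branch r E f \<longleftrightarrow> f 0 = r \<and> (\<forall>i. (f i, f (Suc i)) \<in> E)"

text \<open>
  Since the range of a labelling function is nonempty, the conditions on \<open>Alice\<close> and \<open>Bob\<close>
  nodes force these to have a child. As in the informal definition, further edges, with labels
  outside that range, are permitted.
\<close>

definition is_protocol :: "('v, 'z::countable) protocol \<Rightarrow> bool" where
  "is_protocol P \<longleftrightarrow>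
     rooted_tree (nodes P) (root_node P) (edges P) \<and>
     countable (nodes P) \<and>
     (\<nexists>f. infinite_branch (root_node P) (edges P) f) \<and>
     (\<forall>v\<in>nodes P. case node_label P v of
         Alice a \<Rightarrow> (\<forall>n\<in>range a. \<exists>!w. (v, w) \<in> edges P \<and> edge_label P (v, w) = n)
       | Bob b \<Rightarrow> (\<forall>n\<in>range b. \<exists>!w. (v, w) \<in> edges P \<and> edge_label P (v, w) = n)
       | Leaf z \<Rightarrow> (\<forall>w. (v, w) \<notin> edges P))"

definition step :: "('v, 'z) protocol \<Rightarrow> cantor \<Rightarrow> cantor \<Rightarrow> 'v \<Rightarrow> 'v \<Rightarrow> bool" where
  "step P x y v w \<longleftrightarrow> (v, w) \<in> edges P \<and>
     (case node_label P v of
         Alice a \<Rightarrow> edge_label P (v, w) = a x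
       | Bob b \<Rightarrow> edge_label P (v, w) = b y
       | Leaf z \<Rightarrow> False)"

definition outputs :: "('v, 'z) protocol \<Rightarrow> cantor \<Rightarrow> cantor \<Rightarrow> 'z \<Rightarrow> bool" where
  "outputs P x y z \<longleftrightarrow> (\<exists>v. (step P x y)\<^sup>*\<^sup>* (root_node P) v \<and> node_label P v = Leaf z)"

text \<open>The function computed by a protocol; \<open>ex1_outputs\<close> below shows that it is well defined.\<close>

definition computes :: "('v, 'z) protocol \<Rightarrow> cantor \<Rightarrow> cantor \<Rightarrow> 'z" where
  "computes P x y = (THE z. outputs P x y z)"

definition KW_protocol :: "('v, nat) protocol \<Rightarrow> cantor set \<Rightarrow> cantor set \<Rightarrow> bool" where
  "KW_protocol P A B \<longleftrightarrow> is_protocol P \<and>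
     (\<forall>x\<in>A. \<forall>y\<in>B. x (computes P x y) \<noteq> y (computes P x y))"

lemma protocol_node:
  assumes "is_protocol P" and "v \<in> nodes P"
  shows "case node_label P v of
         Alice a \<Rightarrow> (\<forall>n\<in>range a. \<exists>!w. (v, w) \<in> edges P \<and> edge_label P (v, w) = n)
       | Bob b \<Rightarrow> (\<forall>n\<in>range b. \<exists>!w. (v, w) \<in> edges P \<and> edge_label P (v, w) = n)
       | Leaf z \<Rightarrow> (\<forall>w. (v, w) \<notin> edges P)"
  using assms unfolding is_protocol_def by blast

lemma step_internal:
  assumes P: "is_protocol P" and v: "v \<in> nodes P" and nl: "\<And>z. node_label P v \<noteq> Leaf z"
  shows "\<exists>!w. step P x y v w"
proof (cases "node_label P v")
  case (Alice a)
  then have "\<forall>n\<in>range a. \<exists>!w. (v, w) \<in> edges P \<and> edge_label P (v, w) = n"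
    using protocol_node[OF P v] by simp
  then show ?thesis using Alice by (simp add: step_def)
next
  case (Bob b)
  then have "\<forall>n\<in>range b. \<exists>!w. (v, w) \<in> edges P \<and> edge_label P (v, w) = n"
    using protocol_node[OF P v] by simp
  then show ?thesis using Bob by (simp add: step_def)
qed (use nl in simp)

lemma step_closed:
  assumes "is_protocol P" and "step P x y v w"
  shows "w \<in> nodes P"
  using assms unfolding is_protocol_def rooted_tree_def step_def by blast

lemma step_unique:
  assumes P: "is_protocol P" and v: "v \<in> nodes P" and s: "step P x y v w" "step P x y v w'"
  shows "w = w'"
proof -
  have "node_label P v \<noteq> Leaf z" for z using s(1) by (auto simp: step_def)
  then show ?thesis using step_internal[OF P v] s by blast
qed

lemma ex1_outputs:
  assumes P: "is_protocol P"
  shows "\<exists>!z. outputs P x y z"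
proof -
  let ?r = "root_node P"
  have r: "?r \<in> nodes P" using P by (simp add: is_protocol_def rooted_tree_def)
  have reach_nodes: "v \<in> nodes P" if "(step P x y)\<^sup>*\<^sup>* ?r v" for v
    using that by (induction rule: rtranclp_induct) (auto intro: r step_closed[OF P])
  have ex: "\<exists>z. outputs P x y z"
  proof (rule ccontr)
    assume no: "\<nexists>z. outputs P x y z"
    have prog: "\<exists>w. step P x y v w" if "(step P x y)\<^sup>*\<^sup>* ?r v" for v
    proof -
      have "node_label P v \<noteq> Leaf z" for z using no that by (auto simp: outputs_def)
      then show ?thesis using step_internal[OF P reach_nodes[OF that]] by blast
    qed
    define f where "f = rec_nat ?r (\<lambda>_ v. SOME w. step P x y v w)"
    have f0: "f 0 = ?r" and fS: "f (Suc i) = (SOME w. step P x y (f i) w)" for i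
      by (simp_all add: f_def)
    have fr: "(step P x y)\<^sup>*\<^sup>* ?r (f i)" for i
    proof (induction i)
      case (Suc i)
      have "step P x y (f i) (f (Suc i))"
        unfolding fS by (rule someI_ex[OF prog[OF Suc]])
      with Suc show ?case by (rule rtranclp.rtrancl_into_rtrancl)
    qed (simp add: f0)
    have "step P x y (f i) (f (Suc i))" for i
      unfolding fS by (rule someI_ex[OF prog[OF fr]])
    then have "infinite_branch ?r (edges P) f"
      by (simp add: infinite_branch_def f0 step_def)
    then show False using P by (auto simp: is_protocol_def)
  qed
  have no_step: "\<not> step P x y v w" if "node_label P v = Leaf z" for v w z
    using that by (simp add: step_def)
  have chain: "v = v'"
    if "(step P x y)\<^sup>*\<^sup>* u v" "(step P x y)\<^sup>*\<^sup>* u v'" "u \<in> nodes P"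
      and l: "node_label P v = Leaf z" "node_label P v' = Leaf z'" for u v v' z z'
    using that(1-3)
  proof (induction rule: converse_rtranclp_induct)
    case base
    then show ?case using no_step[OF l(1)] by (metis converse_rtranclpE)
  next
    case (step u u1)
    have "u \<noteq> v'" using step.hyps(1) no_step[OF l(2)] by blast
    with step.prems(1) obtain u2 where u2: "step P x y u u2" "(step P x y)\<^sup>*\<^sup>* u2 v'"
      by (metis converse_rtranclpE)
    have "u2 = u1" using step_unique[OF P step.prems(2) u2(1) step.hyps(1)] .
    then show ?case using step.IH u2(2) step_closed[OF P step.hyps(1)] by blast
  qed
  have "z = z'" if "outputs P x y z" "outputs P x y z'" for z z'
    using that chain[OF _ _ r] unfolding outputs_def by (metis node_label.inject(3))
  with ex show ?thesis by blast
qed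

text \<open>
  As the node set is countable, nothing is lost by taking the nodes to be natural numbers:
  a protocol over any type of nodes can be renamed into one over \<open>nat\<close>.
\<close>

definition rename :: "('v \<Rightarrow> 'w) \<Rightarrow> ('v, 'z) protocol \<Rightarrow> ('w, 'z) protocol" where
  "rename h P = (let g = the_inv_into (nodes P) h in
     \<lparr>nodes = h ` nodes P,
      root_node = h (root_node P),
      edges = map_prod h h ` edges P,
      edge_label = edge_label P \<circ> map_prod g g,
      node_label = node_label P \<circ> g\<rparr>)"

lemma
  assumes P: "is_protocol P" and h: "inj_on h (nodes P)"
  shows is_protocol_rename: "is_protocol (rename h P)"
    and computes_rename: "computes (rename h P) x y = computes P x y"
proof -
  let ?V = "nodes P" and ?E = "edges P" and ?r = "root_node P" and ?Q = "rename h P"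
  define g where "g = the_inv_into ?V h"
  have g: "g (h v) = v" if "v \<in> ?V" for v
    unfolding g_def using h that by (rule the_inv_into_f_f)
  have sel: "nodes ?Q = h ` ?V" "root_node ?Q = h ?r" "edges ?Q = map_prod h h ` ?E"
    "edge_label ?Q = edge_label P \<circ> map_prod g g" "node_label ?Q = node_label P \<circ> g"
    by (simp_all add: rename_def g_def Let_def)
  have tree: "rooted_tree ?V ?r ?E" using P by (simp add: is_protocol_def)
  have r: "?r \<in> ?V" and EV: "?E \<subseteq> ?V \<times> ?V" using tree by (auto simp: rooted_tree_def)
  have hinj: "h v = h w \<longleftrightarrow> v = w" if "v \<in> ?V" "w \<in> ?V" for v w
    using that h by (auto dest: inj_onD)
  have edge: "(h v, h w) \<in> edges ?Q \<longleftrightarrow> (v, w) \<in> ?E" if "v \<in> ?V" "w \<in> ?V" for v w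
  proof
    assume "(h v, h w) \<in> edges ?Q"
    then obtain v' w' where e: "(v', w') \<in> ?E" and eq: "h v = h v'" "h w = h w'" by (auto simp: sel)
    moreover have "v' \<in> ?V" "w' \<in> ?V" using e EV by auto
    ultimately show "(v, w) \<in> ?E" using that by (simp add: hinj)
  qed (force simp: sel)
  have edgeD: "\<exists>v\<in>?V. \<exists>w\<in>?V. p = h v \<and> q = h w \<and> (v, w) \<in> ?E" if "(p, q) \<in> edges ?Q" for p q
    using that EV by (auto simp: sel)
  have elab: "edge_label ?Q (h v, h w) = edge_label P (v, w)" if "v \<in> ?V" "w \<in> ?V" for v w
    using that by (simp add: sel g)
  have nlab: "node_label ?Q (h v) = node_label P v" if "v \<in> ?V" for v
    using that by (simp add: sel g)
  have ex1: "\<exists>!q. (h v, q) \<in> edges ?Q \<and> edge_label ?Q (h v, q) = n"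
    if v: "v \<in> ?V" and ex: "\<exists>!w. (v, w) \<in> ?E \<and> edge_label P (v, w) = n" for v n
  proof -
    obtain w where w: "(v, w) \<in> ?E" "edge_label P (v, w) = n"
      and u: "\<And>w'. (v, w') \<in> ?E \<Longrightarrow> edge_label P (v, w') = n \<Longrightarrow> w' = w"
      using ex by blast
    have wV: "w \<in> ?V" using w EV by blast
    show ?thesis
    proof (rule ex1I[of _ "h w"])
      show "(h v, h w) \<in> edges ?Q \<and> edge_label ?Q (h v, h w) = n"
        using w v wV by (simp add: edge elab)
    next
      fix q assume q: "(h v, q) \<in> edges ?Q \<and> edge_label ?Q (h v, q) = n"
      then obtain w' where w': "w' \<in> ?V" "q = h w'" "(v, w') \<in> ?E"
        using edgeD[of "h v" q] v hinj by blast
      then show "q = h w" using u[of w'] q v by (simp add: elab)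
    qed
  qed
  have tree_Q: "rooted_tree (nodes ?Q) (root_node ?Q) (edges ?Q)"
    unfolding rooted_tree_def
  proof (intro conjI ballI allI)
    show "root_node ?Q \<in> nodes ?Q" using r by (simp add: sel)
    show "edges ?Q \<subseteq> nodes ?Q \<times> nodes ?Q" using EV by (auto simp: sel)
    show "(p, root_node ?Q) \<notin> edges ?Q" for p
    proof
      assume "(p, root_node ?Q) \<in> edges ?Q"
      then obtain v w where "v \<in> ?V" "w \<in> ?V" "h ?r = h w" "(v, w) \<in> ?E"
        using edgeD[of p "root_node ?Q"] by (auto simp: sel(2))
      then have "(v, ?r) \<in> ?E" using r hinj by simp
      then show False using tree by (simp add: rooted_tree_def)
    qed
    show "\<exists>!p. (p, q) \<in> edges ?Q" if q: "q \<in> nodes ?Q - {root_node ?Q}" for q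
    proof -
      obtain w where w: "w \<in> ?V" "q = h w" using q by (auto simp: sel(1))
      have "w \<noteq> ?r" using q w(2) by (auto simp: sel(2))
      then have "\<exists>!v. (v, w) \<in> ?E" using tree w(1) by (simp add: rooted_tree_def)
      then obtain v where v: "(v, w) \<in> ?E" and u: "\<And>v'. (v', w) \<in> ?E \<Longrightarrow> v' = v" by blast
      have vV: "v \<in> ?V" using v EV by blast
      show ?thesis
      proof (rule ex1I[of _ "h v"])
        show "(h v, q) \<in> edges ?Q" using v w vV by (simp add: edge)
        show "p = h v" if "(p, q) \<in> edges ?Q" for p
          using edgeD[OF that] w hinj u by blast
      qed
    qed
    show "(root_node ?Q, q) \<in> (edges ?Q)\<^sup>*" if q: "q \<in> nodes ?Q" for q
    proof -
      obtain w where w: "w \<in> ?V" "q = h w" using q by (auto simp: sel)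
      have "(?r, w) \<in> ?E\<^sup>*" using tree w by (simp add: rooted_tree_def)
      then have "(h ?r, h w) \<in> (edges ?Q)\<^sup>*"
      proof (induction rule: rtrancl_induct)
        case (step v w)
        then have "(h v, h w) \<in> edges ?Q" using EV by (subst edge) auto
        with step.IH show ?case by (rule rtrancl.rtrancl_into_rtrancl)
      qed simp
      then show ?thesis using w by (simp add: sel)
    qed
  qed
  have no_branch: "\<nexists>f. infinite_branch (root_node ?Q) (edges ?Q) f"
  proof
    assume "\<exists>f. infinite_branch (root_node ?Q) (edges ?Q) f"
    then obtain f where f: "f 0 = h ?r" "\<And>i. (f i, f (Suc i)) \<in> edges ?Q"
      by (auto simp: infinite_branch_def sel)
    have "(g (f i), g (f (Suc i))) \<in> ?E" for i using edgeD[OF f(2)[of i]] g by auto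
    then have "infinite_branch ?r ?E (g \<circ> f)" by (simp add: infinite_branch_def f g r)
    then show False using P by (auto simp: is_protocol_def)
  qed
  have local: "case node_label ?Q q of
         Alice a \<Rightarrow> (\<forall>n\<in>range a. \<exists>!w. (q, w) \<in> edges ?Q \<and> edge_label ?Q (q, w) = n)
       | Bob b \<Rightarrow> (\<forall>n\<in>range b. \<exists>!w. (q, w) \<in> edges ?Q \<and> edge_label ?Q (q, w) = n)
       | Leaf z \<Rightarrow> (\<forall>w. (q, w) \<notin> edges ?Q)" if "q \<in> nodes ?Q" for q
  proof -
    obtain v where v: "v \<in> ?V" "q = h v" using \<open>q \<in> nodes ?Q\<close> by (auto simp: sel)
    have c: "case node_label P v of
         Alice a \<Rightarrow> (\<forall>n\<in>range a. \<exists>!w. (v, w) \<in> ?E \<and> edge_label P (v, w) = n)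
       | Bob b \<Rightarrow> (\<forall>n\<in>range b. \<exists>!w. (v, w) \<in> ?E \<and> edge_label P (v, w) = n)
       | Leaf z \<Rightarrow> (\<forall>w. (v, w) \<notin> ?E)"
      by (rule protocol_node[OF P v(1)])
    note nl = nlab[OF v(1)]
    show ?thesis
    proof (cases "node_label P v")
      case (Alice a)
      then show ?thesis using c ex1[OF v(1)] unfolding v(2) nl by simp
    next
      case (Bob b)
      then show ?thesis using c ex1[OF v(1)] unfolding v(2) nl by simp
    next
      case (Leaf z)
      then have "\<forall>w. (v, w) \<notin> ?E" using c by simp
      then have "(h v, w) \<notin> edges ?Q" for w
        using edgeD[of "h v" w] hinj v(1) by blast
      then show ?thesis using Leaf unfolding v(2) nl by simp
    qed
  qed
  show Q: "is_protocol ?Q"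
    unfolding is_protocol_def using tree_Q no_branch local P
    by (simp add: is_protocol_def sel(1))
  have step_Q: "step ?Q x y (h v) (h w)" if "step P x y v w" for v w
  proof -
    have "v \<in> ?V" "w \<in> ?V" using that EV by (auto simp: step_def)
    then show ?thesis using that
      by (simp add: step_def edge elab nlab split: node_label.splits)
  qed
  obtain z where z: "outputs P x y z" using ex1_outputs[OF P] by blast
  then obtain v where v: "(step P x y)\<^sup>*\<^sup>* ?r v" "node_label P v = Leaf z"
    by (auto simp: outputs_def)
  have "(step ?Q x y)\<^sup>*\<^sup>* (h ?r) (h v) \<and> v \<in> ?V" using v(1)
    by (induction rule: rtranclp_induct)
      (auto simp: r intro: rtranclp.rtrancl_into_rtrancl step_Q step_closed[OF P])
  then have "outputs ?Q x y z" using v(2) nlab by (auto simp: outputs_def sel(2))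
  then show "computes ?Q x y = computes P x y"
    unfolding computes_def
    using z ex1_outputs[OF P, of x y] ex1_outputs[OF Q, of x y] by (metis the1_equality)
qed

lemma KW_protocol_nat:
  fixes P :: "('v, nat) protocol"
  assumes "KW_protocol P A B"
  shows "\<exists>Q :: (nat, nat) protocol. KW_protocol Q A B"
proof -
  have P: "is_protocol P" using assms by (simp add: KW_protocol_def)
  then have "inj_on (to_nat_on (nodes P)) (nodes P)"
    by (simp add: is_protocol_def inj_on_to_nat_on)
  then have "KW_protocol (rename (to_nat_on (nodes P)) P) A B"
    using assms P by (simp add: KW_protocol_def is_protocol_rename computes_rename)
  then show ?thesis by blast
qed

end

theory Submission
  imports Defs
begin

text \<open>
  Protocols and Borel codes are the same trees, read in two ways.

  From a set to a protocol: the sets whose game is solvable form a \<open>\<sigma>\<close>-algebra that contains the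
  subbasic clopen sets. If membership depends on the single coordinate \<open>i\<close>, then \<open>i\<close> is always a
  correct answer. Exchanging the players turns a protocol for \<open>S\<close> into one for \<open>- S\<close>. For a union
  \<open>\<Union>i. S i\<close>, Alice announces some \<open>i\<close> with \<open>x \<in> S i\<close>; Bob's \<open>y\<close> is outside \<open>S i\<close>, so the players
  can go on with the protocol for \<open>S i\<close> (\<open>KW_solvable_UN\<close>). As the Borel \<open>\<sigma>\<close>-algebra is generated
  by the subbasic sets, every Borel game is solvable (\<open>borel_imp_KW_solvable\<close>).

  From a protocol to a set: the labelling functions are arbitrary, so the sets of inputs that lead
  to a given node need not be Borel. What survives is Borel separation. If the protocol, started at
  a node \<open>v\<close>, is correct on a rectangle \<open>A \<times> B\<close>, then some Borel set contains \<open>A\<close> and misses \<open>B\<close>.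
  This is proved by induction along the well-founded tree (\<open>separated_at_node\<close>): at a node of Alice,
  \<open>A\<close> splits into countably many pieces according to her message, and the union of the separating
  sets works; a node of Bob is dual; at a leaf the answer \<open>i\<close> forces the value \<open>x i\<close> to be constant
  on \<open>A\<close>. At the root the rectangle is \<open>S \<times> - S\<close>, and only \<open>S\<close> itself separates \<open>S\<close> from \<open>- S\<close>.
\<close>

section \<open>Borel separation\<close>

definition borel_separated :: "'a::topological_space set \<Rightarrow> 'a set \<Rightarrow> bool" where
  "borel_separated A B \<longleftrightarrow> (\<exists>C\<in>sets borel. A \<subseteq> C \<and> C \<inter> B = {})"

lemma borel_separated_commute: "borel_separated A B \<Longrightarrow> borel_separated B A"
proof -
  assume "borel_separated A B"
  then obtain C where C: "C \<in> sets borel" "A \<subseteq> C" "C \<inter> B = {}"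
    unfolding borel_separated_def by blast
  then have "- C \<in> sets borel" "B \<subseteq> - C" "- C \<inter> A = {}"
    by (auto intro: borel_comp)
  then show ?thesis
    unfolding borel_separated_def by (intro bexI[of _ "- C"] conjI)
qed

lemma borel_separated_UN:
  assumes "\<And>n::nat. borel_separated (A n) B"
  shows "borel_separated (\<Union>n. A n) B"
proof -
  from assms obtain C where "\<And>n. C n \<in> sets borel \<and> A n \<subseteq> C n \<and> C n \<inter> B = {}"
    unfolding borel_separated_def by metis
  then have "(\<Union>n. C n) \<in> sets borel" "(\<Union>n. A n) \<subseteq> (\<Union>n. C n)" "(\<Union>n. C n) \<inter> B = {}"
    by auto
  then show ?thesis
    unfolding borel_separated_def by blast
qed

lemma borel_separated_empty: "borel_separated {} B"
  unfolding borel_separated_def by (intro bexI[of _ "{}"]) auto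

lemma borel_separated_self_Compl: "borel_separated S (- S) \<Longrightarrow> S \<in> sets borel"
proof -
  assume "borel_separated S (- S)"
  then obtain C where "C \<in> sets borel" "S \<subseteq> C" "C \<inter> - S = {}"
    unfolding borel_separated_def by blast
  moreover from this have "S = C"
    by blast
  ultimately show ?thesis
    by simp
qed

lemma coordinate_vimage_borel: "{x :: cantor. x i \<in> T} \<in> sets borel"
proof -
  have "open ((\<lambda>x :: cantor. x i) -` T)"
    by (intro open_vimage open_discrete continuous_on_product_coordinates)
  then show ?thesis
    by (simp add: vimage_def)
qed

text \<open>
  On a nonempty rectangle, an index at which all pairs differ takes one value on \<open>A\<close> and the
  opposite one on \<open>B\<close>, since there are only two values.
\<close>

lemma borel_separated_coordinate:
  fixes A B :: "cantor set"
  assumes "\<And>x y. x \<in> A \<Longrightarrow> y \<in> B \<Longrightarrow> x i \<noteq> y i"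
  shows "borel_separated A B"
proof (cases "B = {}")
  case True
  then show ?thesis
    using borel_separated_empty borel_separated_commute by blast
next
  case False
  then have "A \<subseteq> {x. x i \<in> (\<lambda>x. x i) ` A}" "{x. x i \<in> (\<lambda>x. x i) ` A} \<inter> B = {}"
    using assms by auto
  then show ?thesis
    unfolding borel_separated_def
    by (intro bexI[of _ "{x. x i \<in> (\<lambda>x. x i) ` A}"] conjI coordinate_vimage_borel)
qed

section \<open>Protocols separate by Borel sets\<close>

text \<open>
  Otherwise the failure of \<open>Q\<close> at the root would be inherited by a child forever, which is an
  infinite branch.
\<close>

lemma protocol_root_induct:
  assumes P: "is_protocol P"
    and children: "\<And>v. v \<in> nodes P \<Longrightarrow> (\<And>w. (v, w) \<in> edges P \<Longrightarrow> Q w) \<Longrightarrow> Q v"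
  shows "Q (root_node P)"
proof (rule ccontr)
  assume nQ: "\<not> Q (root_node P)"
  have V: "root_node P \<in> nodes P" "edges P \<subseteq> nodes P \<times> nodes P"
    using P by (auto simp: is_protocol_def rooted_tree_def)
  have "\<exists>f. \<forall>n. (f n \<in> nodes P \<and> \<not> Q (f n) \<and> (n = 0 \<longrightarrow> f n = root_node P)) \<and>
      (f n, f (Suc n)) \<in> edges P"
  proof (rule dependent_nat_choice)
    show "\<exists>v. v \<in> nodes P \<and> \<not> Q v \<and> (0 = (0::nat) \<longrightarrow> v = root_node P)"
      using V nQ by blast
  next
    fix v and n :: nat
    assume "v \<in> nodes P \<and> \<not> Q v \<and> (n = 0 \<longrightarrow> v = root_node P)"
    then show "\<exists>w. (w \<in> nodes P \<and> \<not> Q w \<and> (Suc n = 0 \<longrightarrow> w = root_node P)) \<and> (v, w) \<in> edges P"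
      using children[of v] V by blast
  qed
  then show False
    using P unfolding is_protocol_def infinite_branch_def by blast
qed

text \<open>
  Correctness of a protocol when it is started at an arbitrary node. Considering all leaves that are
  reachable from \<open>v\<close> makes the notion pass to children without any reference to the path from the
  root to \<open>v\<close>.
\<close>

definition correct_from ::
  "('v, nat) protocol \<Rightarrow> 'v \<Rightarrow> cantor set \<Rightarrow> cantor set \<Rightarrow> bool" where
  "correct_from P v A B \<longleftrightarrow>
     (\<forall>x\<in>A. \<forall>y\<in>B. \<forall>u z. (step P x y)\<^sup>*\<^sup>* v u \<longrightarrow> node_label P u = Leaf z \<longrightarrow> x z \<noteq> y z)"

lemma correct_from_child:
  assumes "correct_from P v A B" "A' \<subseteq> A" "B' \<subseteq> B"
    and "\<And>x y. x \<in> A' \<Longrightarrow> y \<in> B' \<Longrightarrow> step P x y v w"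
  shows "correct_from P w A' B'"
  unfolding correct_from_def
proof (intro ballI allI impI)
  fix x y u z
  assume xy: "x \<in> A'" "y \<in> B'" and u: "(step P x y)\<^sup>*\<^sup>* w u" "node_label P u = Leaf z"
  have "(step P x y)\<^sup>*\<^sup>* v u"
    using assms(4)[OF xy] u(1) by (rule converse_rtranclp_into_rtranclp)
  then show "x z \<noteq> y z"
    using assms(1-3) xy u(2) unfolding correct_from_def by blast
qed

lemma separated_at_node:
  fixes P :: "('v, nat) protocol"
  assumes P: "is_protocol P" and v: "v \<in> nodes P"
    and IH: "\<And>w A B. (v, w) \<in> edges P \<Longrightarrow> correct_from P w A B \<Longrightarrow> borel_separated A B"
    and correct: "correct_from P v A B"
  shows "borel_separated A B"
proof (cases "node_label P v")
  case (Leaf z)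
  then have "x z \<noteq> y z" if "x \<in> A" "y \<in> B" for x y
    using correct that unfolding correct_from_def by blast
  then show ?thesis
    by (rule borel_separated_coordinate)
next
  case (Alice a)
  define A' where "A' n = {x \<in> A. a x = n}" for n
  have "borel_separated (A' n) B" for n
  proof (cases "n \<in> range a")
    case True
    then have "\<exists>!w. (v, w) \<in> edges P \<and> edge_label P (v, w) = n"
      using protocol_node[OF P v] Alice by auto
    then obtain w where "(v, w) \<in> edges P" "edge_label P (v, w) = n"
      by blast
    moreover from this have "correct_from P w (A' n) B"
      using Alice by (intro correct_from_child[OF correct]) (auto simp: A'_def step_def)
    ultimately show ?thesis
      using IH by blast
  next
    \<comment> \<open>There need not be an edge for a message that is never sent, but then the piece is empty.\<close>
    case False
    then have "A' n = {}"
      by (auto simp: A'_def)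
    then show ?thesis
      by (simp add: borel_separated_empty)
  qed
  moreover have "A = (\<Union>n. A' n)"
    by (auto simp: A'_def)
  ultimately show ?thesis
    using borel_separated_UN by metis
next
  case (Bob b)
  define B' where "B' n = {y \<in> B. b y = n}" for n
  have "borel_separated (B' n) A" for n
  proof (cases "n \<in> range b")
    case True
    then have "\<exists>!w. (v, w) \<in> edges P \<and> edge_label P (v, w) = n"
      using protocol_node[OF P v] Bob by auto
    then obtain w where "(v, w) \<in> edges P" "edge_label P (v, w) = n"
      by blast
    moreover from this have "correct_from P w A (B' n)"
      using Bob by (intro correct_from_child[OF correct]) (auto simp: B'_def step_def)
    ultimately show ?thesis
      using IH borel_separated_commute by blast
  next
    case False
    then have "B' n = {}"
      by (auto simp: B'_def)
    then show ?thesis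
      by (simp add: borel_separated_empty)
  qed
  moreover have "B = (\<Union>n. B' n)"
    by (auto simp: B'_def)
  ultimately show ?thesis
    using borel_separated_UN borel_separated_commute by metis
qed

lemma computes_eqI:
  assumes "is_protocol P" "outputs P x y z"
  shows "computes P x y = z"
  unfolding computes_def using ex1_outputs[OF assms(1)] assms(2) by (rule the1_equality)

lemma outputs_computes: "is_protocol P \<Longrightarrow> outputs P x y (computes P x y)"
  unfolding computes_def by (drule ex1_outputs) (erule theI')

theorem KW_protocol_imp_borel_separated:
  assumes "KW_protocol P A B"
  shows "borel_separated A B"
proof -
  have P: "is_protocol P"
    using assms by (simp add: KW_protocol_def)
  have "\<forall>A B. correct_from P (root_node P) A B \<longrightarrow> borel_separated A B"
    using P by (rule protocol_root_induct) (use separated_at_node[OF P] in blast)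
  moreover have "correct_from P (root_node P) A B"
    unfolding correct_from_def
  proof (intro ballI allI impI)
    fix x y u z
    assume xy: "x \<in> A" "y \<in> B"
      and u: "(step P x y)\<^sup>*\<^sup>* (root_node P) u" "node_label P u = Leaf z"
    have "computes P x y = z"
      using u by (intro computes_eqI P) (auto simp: outputs_def)
    moreover have "x (computes P x y) \<noteq> y (computes P x y)"
      using assms xy unfolding KW_protocol_def by blast
    ultimately show "x z \<noteq> y z"
      by (simp only: simp_thms)
  qed
  ultimately show ?thesis
    by blast
qed

section \<open>Building protocols\<close>

definition constant_protocol :: "'z \<Rightarrow> (unit, 'z) protocol" where
  "constant_protocol z =
     \<lparr>nodes = {()}, root_node = (), edges = {}, edge_label = (\<lambda>_. 0), node_label = (\<lambda>_. Leaf z)\<rparr>"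

lemma is_protocol_constant_protocol: "is_protocol (constant_protocol z)"
  by (simp add: is_protocol_def constant_protocol_def rooted_tree_def infinite_branch_def)

lemma computes_constant_protocol: "computes (constant_protocol (z :: 'z::countable)) x y = z"
  by (intro computes_eqI is_protocol_constant_protocol)
    (auto simp: outputs_def constant_protocol_def)

fun swap_label :: "'z node_label \<Rightarrow> 'z node_label" where
  "swap_label (Alice a) = Bob a"
| "swap_label (Bob b) = Alice b"
| "swap_label (Leaf z) = Leaf z"

lemma swap_label_eq_Leaf: "swap_label l = Leaf z \<longleftrightarrow> l = Leaf z"
  by (cases l) auto

definition swap_protocol :: "('v, 'z) protocol \<Rightarrow> ('v, 'z) protocol" where
  "swap_protocol P = P\<lparr>node_label := swap_label \<circ> node_label P\<rparr>"

lemma is_protocol_swap_protocol: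
  assumes "is_protocol P"
  shows "is_protocol (swap_protocol P)"
proof -
  have "case swap_label (node_label P v) of
         Alice a \<Rightarrow> (\<forall>n\<in>range a. \<exists>!w. (v, w) \<in> edges P \<and> edge_label P (v, w) = n)
       | Bob b \<Rightarrow> (\<forall>n\<in>range b. \<exists>!w. (v, w) \<in> edges P \<and> edge_label P (v, w) = n)
       | Leaf z \<Rightarrow> (\<forall>w. (v, w) \<notin> edges P)" if "v \<in> nodes P" for v
    using protocol_node[OF assms that] by (cases "node_label P v") auto
  moreover have "nodes (swap_protocol P) = nodes P" "root_node (swap_protocol P) = root_node P"
    "edges (swap_protocol P) = edges P" "edge_label (swap_protocol P) = edge_label P"
    "\<And>v. node_label (swap_protocol P) v = swap_label (node_label P v)"
    by (simp_all add: swap_protocol_def)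
  ultimately show ?thesis
    using assms unfolding is_protocol_def by (simp only: simp_thms) blast
qed

lemma computes_swap_protocol: "computes (swap_protocol P) x y = computes P y x"
proof -
  have "step (swap_protocol P) x y = step P y x"
    by (auto simp: fun_eq_iff step_def swap_protocol_def split: node_label.splits)
  moreover have "node_label (swap_protocol P) v = swap_label (node_label P v)"
    "root_node (swap_protocol P) = root_node P" for v
    by (simp_all add: swap_protocol_def)
  ultimately have "outputs (swap_protocol P) x y = outputs P y x"
    by (intro ext) (simp add: outputs_def swap_label_eq_Leaf)
  then show ?thesis
    by (simp add: computes_def)
qed

text \<open>
  Alice sends \<open>a x\<close> from a new root, and the players continue with the protocol of that number.
  An edge from the new root is therefore labelled by the index of the subtree that it enters. The
  nodes are tagged to keep the subtrees disjoint; \<open>None\<close> is the new root.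
\<close>

definition glue :: "(cantor \<Rightarrow> nat) \<Rightarrow> (nat \<Rightarrow> ('v, 'z) protocol) \<Rightarrow> ((nat \<times> 'v) option, 'z) protocol"
  where
  "glue a P =
     \<lparr>nodes = insert None (Some ` (SIGMA i:UNIV. nodes (P i))),
      root_node = None,
      edges = {(None, Some (i, root_node (P i))) | i. True} \<union>
              {(Some (i, v), Some (i, w)) | i v w. (v, w) \<in> edges (P i)},
      edge_label = (\<lambda>(p, q). case p of
          None \<Rightarrow> fst (the q)
        | Some (i, v) \<Rightarrow> edge_label (P i) (v, snd (the q))),
      node_label = (\<lambda>p. case p of None \<Rightarrow> Alice a | Some (i, v) \<Rightarrow> node_label (P i) v)\<rparr>"

context
  fixes a :: "cantor \<Rightarrow> nat" and P :: "nat \<Rightarrow> ('v, 'z::countable) protocol"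
  assumes P: "\<And>i. is_protocol (P i)"
begin

lemma glue_sel:
  "nodes (glue a P) = insert None (Some ` (SIGMA i:UNIV. nodes (P i)))"
  "root_node (glue a P) = None"
  "(None, q) \<in> edges (glue a P) \<longleftrightarrow> (\<exists>i. q = Some (i, root_node (P i)))"
  "(Some (i, v), q) \<in> edges (glue a P) \<longleftrightarrow> (\<exists>w. q = Some (i, w) \<and> (v, w) \<in> edges (P i))"
  "(p, None) \<notin> edges (glue a P)"
  "(p, Some (i, w)) \<in> edges (glue a P) \<longleftrightarrow>
     p = None \<and> w = root_node (P i) \<or> (\<exists>v. p = Some (i, v) \<and> (v, w) \<in> edges (P i))"
  "edge_label (glue a P) (None, Some (j, w)) = j"
  "edge_label (glue a P) (Some (i, v), Some (j, w)) = edge_label (P i) (v, w)"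
  "node_label (glue a P) None = Alice a"
  "node_label (glue a P) (Some (i, v)) = node_label (P i) v"
  by (auto simp: glue_def)

lemma tree: "rooted_tree (nodes (P i)) (root_node (P i)) (edges (P i))"
  using P by (simp add: is_protocol_def)

lemma rooted_tree_glue: "rooted_tree (nodes (glue a P)) (root_node (glue a P)) (edges (glue a P))"
  unfolding rooted_tree_def
proof (intro conjI ballI allI)
  show "root_node (glue a P) \<in> nodes (glue a P)"
    by (simp add: glue_sel)
  show "edges (glue a P) \<subseteq> nodes (glue a P) \<times> nodes (glue a P)"
    using tree by (fastforce simp: glue_def rooted_tree_def)
  show "(p, root_node (glue a P)) \<notin> edges (glue a P)" for p
    by (simp add: glue_sel)
  show "\<exists>!p. (p, q) \<in> edges (glue a P)" if q_node: "q \<in> nodes (glue a P) - {root_node (glue a P)}" for q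
  proof -
    obtain i w where q: "q = Some (i, w)" and w: "w \<in> nodes (P i)"
      using q_node by (auto simp: glue_sel)
    show ?thesis
    proof (cases "w = root_node (P i)")
      case True
      then have "(v, w) \<notin> edges (P i)" for v
        using tree by (simp add: rooted_tree_def)
      then show ?thesis
        using True by (auto simp: q glue_sel)
    next
      case False
      then have "\<exists>!v. (v, w) \<in> edges (P i)"
        using tree w by (simp add: rooted_tree_def)
      then show ?thesis
        using False unfolding q glue_sel by blast
    qed
  qed
  show "(root_node (glue a P), q) \<in> (edges (glue a P))\<^sup>*" if q_node: "q \<in> nodes (glue a P)" for q
  proof (cases q)
    case None
    then show ?thesis
      by (simp add: glue_sel)
  next
    case (Some p)
    then obtain i w where q: "q = Some (i, w)" and w: "w \<in> nodes (P i)"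
      using q_node by (auto simp: glue_sel)
    have "(root_node (P i), w) \<in> (edges (P i))\<^sup>*"
      using tree w by (simp add: rooted_tree_def)
    then have "(None, Some (i, w)) \<in> (edges (glue a P))\<^sup>*"
    proof (induction rule: rtrancl_induct)
      case base
      show ?case
        by (rule r_into_rtrancl) (simp add: glue_sel)
    next
      case (step v w)
      then show ?case
        by (meson glue_sel(4) rtrancl.rtrancl_into_rtrancl)
    qed
    then show ?thesis
      by (simp add: q glue_sel(2))
  qed
qed

text \<open>The first step of a branch picks a subtree, and the branch stays in it from then on.\<close>

lemma no_infinite_branch_glue: "\<not> infinite_branch (root_node (glue a P)) (edges (glue a P)) f"
proof
  assume "infinite_branch (root_node (glue a P)) (edges (glue a P)) f"
  then have f: "f 0 = None" "\<And>n. (f n, f (Suc n)) \<in> edges (glue a P)"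
    by (auto simp: infinite_branch_def glue_sel)
  obtain i where i: "f (Suc 0) = Some (i, root_node (P i))"
    using f(2)[of 0] by (auto simp: f(1) glue_sel)
  define g where "g n = snd (the (f (Suc n)))" for n
  have fg: "f (Suc n) = Some (i, g n)" for n
  proof (induction n)
    case 0
    show ?case
      by (simp add: g_def i)
  next
    case (Suc n)
    then obtain w where "f (Suc (Suc n)) = Some (i, w)"
      using f(2)[of "Suc n"] by (auto simp: glue_sel(4))
    then show ?case
      by (simp add: g_def)
  qed
  have "(g n, g (Suc n)) \<in> edges (P i)" for n
    using f(2)[of "Suc n"] by (simp add: fg glue_sel)
  moreover have "g 0 = root_node (P i)"
    by (simp add: g_def i)
  ultimately show False
    using P[of i] unfolding is_protocol_def infinite_branch_def by blast
qed

lemma is_protocol_glue: "is_protocol (glue a P)"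
proof -
  have "countable (nodes (P i))" for i
    using P by (simp add: is_protocol_def)
  then have "countable (nodes (glue a P))"
    unfolding glue_sel by (intro countable_insert countable_image countable_SIGMA) auto
  moreover
  have lift: "\<exists>!q. (Some (i, v), q) \<in> edges (glue a P) \<and> edge_label (glue a P) (Some (i, v), q) = n"
    if "\<exists>!w. (v, w) \<in> edges (P i) \<and> edge_label (P i) (v, w) = n" for i v n
    using that by (auto simp: glue_sel)
  have "case node_label (glue a P) q of
         Alice a' \<Rightarrow> (\<forall>n\<in>range a'. \<exists>!w. (q, w) \<in> edges (glue a P) \<and> edge_label (glue a P) (q, w) = n)
       | Bob b \<Rightarrow> (\<forall>n\<in>range b. \<exists>!w. (q, w) \<in> edges (glue a P) \<and> edge_label (glue a P) (q, w) = n)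
       | Leaf z \<Rightarrow> (\<forall>w. (q, w) \<notin> edges (glue a P))" if q: "q \<in> nodes (glue a P)" for q
  proof (cases q)
    case None
    then show ?thesis
      by (auto simp: glue_sel)
  next
    case (Some p)
    then obtain i v where q': "q = Some (i, v)" and v: "v \<in> nodes (P i)"
      using q by (auto simp: glue_sel)
    show ?thesis
      using protocol_node[OF P v] lift[where i = i and v = v] unfolding q' glue_sel(10)
      by (cases "node_label (P i) v") (auto simp: glue_sel(4))
  qed
  ultimately show ?thesis
    unfolding is_protocol_def using rooted_tree_glue no_infinite_branch_glue by blast
qed

lemma computes_glue: "computes (glue a P) x y = computes (P (a x)) x y"
proof (rule computes_eqI[OF is_protocol_glue])
  obtain u where u: "(step (P (a x)) x y)\<^sup>*\<^sup>* (root_node (P (a x))) u"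
    "node_label (P (a x)) u = Leaf (computes (P (a x)) x y)"
    using outputs_computes[OF P] unfolding outputs_def by blast
  have "(step (glue a P) x y)\<^sup>*\<^sup>* None (Some (a x, u))"
    using u(1)
  proof (induction rule: rtranclp_induct)
    case base
    show ?case
      by (rule r_into_rtranclp) (simp add: step_def glue_sel)
  next
    case (step v w)
    then have "step (glue a P) x y (Some (a x, v)) (Some (a x, w))"
      by (simp add: step_def glue_sel split: node_label.splits)
    with step.IH show ?case
      by (rule rtranclp.rtrancl_into_rtrancl)
  qed
  then show "outputs (glue a P) x y (computes (P (a x)) x y)"
    using u(2) unfolding outputs_def glue_sel(2) by (metis glue_sel(10))
qed

end

section \<open>Borel games are solvable\<close>

definition KW_solvable :: "cantor set \<Rightarrow> cantor set \<Rightarrow> bool" where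
  "KW_solvable A B \<longleftrightarrow> (\<exists>P :: (nat, nat) protocol. KW_protocol P A B)"

lemma KW_solvable_coordinate: "KW_solvable {x. x i \<in> T} (- {x. x i \<in> T})"
proof -
  have "x i \<noteq> y i" if "x \<in> {x. x i \<in> T}" "y \<in> - {x. x i \<in> T}" for x y
  proof
    assume "x i = y i"
    then show False
      using that by simp
  qed
  then have "KW_protocol (constant_protocol i) {x. x i \<in> T} (- {x. x i \<in> T})"
    unfolding KW_protocol_def computes_constant_protocol
    using is_protocol_constant_protocol by blast
  then show ?thesis
    unfolding KW_solvable_def by (rule KW_protocol_nat)
qed

lemma KW_solvable_commute:
  assumes "KW_solvable A B"
  shows "KW_solvable B A"
proof -
  obtain P :: "(nat, nat) protocol" where "KW_protocol P A B"
    using assms by (auto simp: KW_solvable_def)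
  then have "KW_protocol (swap_protocol P) B A"
    by (simp add: KW_protocol_def is_protocol_swap_protocol computes_swap_protocol) metis
  then show ?thesis
    unfolding KW_solvable_def by blast
qed

text \<open>
  Bob has to be in the same set \<open>B\<close> for all \<open>i\<close>: Alice's choice of \<open>i\<close> is made without looking at
  \<open>y\<close>, so whatever she chooses, \<open>y\<close> must be a legal input of the game for \<open>A i\<close>.
\<close>

lemma KW_solvable_UN:
  assumes "\<And>i::nat. KW_solvable (A i) B"
  shows "KW_solvable (\<Union>i. A i) B"
proof -
  obtain P :: "nat \<Rightarrow> (nat, nat) protocol" where P: "\<And>i. KW_protocol (P i) (A i) B"
    using assms unfolding KW_solvable_def by metis
  define a where "a x = (SOME i. x \<in> A i)" for x
  have prot: "is_protocol (P i)" for i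
    using P by (simp add: KW_protocol_def)
  have a: "x \<in> A (a x)" if "x \<in> (\<Union>i. A i)" for x
    using that unfolding a_def by (auto intro: someI)
  have "KW_protocol (glue a P) (\<Union>i. A i) B"
    unfolding KW_protocol_def
  proof (intro conjI ballI is_protocol_glue prot)
    fix x y
    assume "x \<in> (\<Union>i. A i)" "y \<in> B"
    then show "x (computes (glue a P) x y) \<noteq> y (computes (glue a P) x y)"
      using P[of "a x"] a by (simp add: computes_glue[OF prot] KW_protocol_def)
  qed
  then show ?thesis
    unfolding KW_solvable_def by (rule KW_protocol_nat)
qed

lemma KW_solvable_mono:
  assumes "KW_solvable A B" "A' \<subseteq> A" "B' \<subseteq> B"
  shows "KW_solvable A' B'"
proof -
  obtain P :: "(nat, nat) protocol" where "KW_protocol P A B"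
    using assms(1) by (auto simp: KW_solvable_def)
  then have "KW_protocol P A' B'"
    using assms(2,3) by (simp add: KW_protocol_def subset_iff)
  then show ?thesis
    unfolding KW_solvable_def by (rule exI)
qed

text \<open>
  Second countability of the factors is what identifies the Borel \<open>\<sigma>\<close>-algebra of a countable power
  with the product \<open>\<sigma>\<close>-algebra.
\<close>

instance bool :: second_countable_topology
proof
  have "open = generate_topology (UNIV :: bool set set)"
    by (auto simp: fun_eq_iff open_discrete intro: generate_topology.Basis)
  then show "\<exists>B :: bool set set. countable B \<and> open = generate_topology B"
    by (intro exI[of _ UNIV]) (simp add: countable_finite)
qed

theorem borel_imp_KW_solvable:
  assumes "S \<in> sets borel"
  shows "KW_solvable S (- S)"
proof -
  \<comment> \<open>The Borel sets of a countable power are generated by conditions on single coordinates.\<close>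
  have "S \<in> sets (Pi\<^sub>M UNIV (\<lambda>_::nat. borel :: bool measure))"
    using assms by (simp add: sets_PiM_equal_borel)
  then have "S \<in> sigma_sets UNIV {{x. x i \<in> T} | i T. i \<in> UNIV \<and> T \<in> sets borel}"
    by (simp add: sets_PiM_single)
  then show ?thesis
  proof (induction rule: sigma_sets.induct)
    case (Basic S)
    then show ?case
      using KW_solvable_coordinate by auto
  next
    case Empty
    show ?case
      using KW_solvable_coordinate[of 0 "{}"] by simp
  next
    case (Compl S)
    then show ?case
      using KW_solvable_commute by (simp add: Compl_eq_Diff_UNIV[symmetric])
  next
    case (Union S)
    have "KW_solvable (S i) (- (\<Union>i. S i))" for i
      using Union.IH[of i] by (rule KW_solvable_mono) auto
    then show ?case
      by (rule KW_solvable_UN)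
  qed
qed

theorem corollary5p9:
  fixes S :: "cantor set"
  shows "S \<in> sets borel \<longleftrightarrow> (\<exists>P :: (nat, nat) protocol. KW_protocol P S (- S))"
proof
  assume "S \<in> sets borel"
  then show "\<exists>P :: (nat, nat) protocol. KW_protocol P S (- S)"
    unfolding KW_solvable_def[symmetric] by (rule borel_imp_KW_solvable)
next
  assume "\<exists>P :: (nat, nat) protocol. KW_protocol P S (- S)"
  then obtain P :: "(nat, nat) protocol" where "KW_protocol P S (- S)" ..
  then show "S \<in> sets borel"
    by (intro borel_separated_self_Compl KW_protocol_imp_borel_separated)
qed

end
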